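(* The only right-symmetric points of $\ell_1$ are the scalar multiples of $e_n$, for $n\in\mathbb{N}$; that is, $a\in\ell_1$ is right-symmetric if and only if $a=ce_n$ for some $n\in\mathbb{N}$ and some $c\in\mathbb{K}$.
   Context: $\ell_1$ is the space of absolutely summable sequences in $\mathbb{K}$ ($\mathbb{K}=\mathbb{R}$ or $\mathbb{C}$) with norm $\|a\|_1=\sum_n|a_n|$. In a normed space $\mathbb{X}$ over $\mathbb{K}$, $x\perp_B y$ means $\|x+\lambda y\|\ge\|x\|$ for all $\lambda\in\mathbb{K}$. A point $x\in\mathbb{X}$ is right-symmetric if for every $y\in\mathbb{X}$, $y\perp_B x$ implies $x\perp_B y$. $e_n$ is the sequence whose $n$-th term is $1$ and whose other terms are $0$. *)

theory Defs
  imports Complex_Main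
begin

text \<open>
  HOL has no type class of complex normed spaces. A normed space over a field \<open>'k\<close>
  (below, \<open>real\<close> or \<open>complex\<close>) is a type of class \<^class>\<open>real_normed_vector\<close> together with a scalar
  multiplication by \<open>'k\<close> that extends \<^const>\<open>scaleR\<close> and for which the norm is
  absolutely homogeneous.
\<close>

locale normed_space_over = vector_space scale
  for scale :: "'k::real_normed_field \<Rightarrow> 'v::real_normed_vector \<Rightarrow> 'v" +
  assumes scale_of_real: "scale (of_real r) x = r *\<^sub>R x"
    and norm_scale: "norm (scale c x) = norm c * norm x"
begin

definition birkhoff_orthogonal :: "'v \<Rightarrow> 'v \<Rightarrow> bool"
  where "birkhoff_orthogonal x y \<longleftrightarrow> (\<forall>c. norm (x + scale c y) \<ge> norm x)"

definition right_symmetric :: "'v \<Rightarrow> bool"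
  where "right_symmetric x \<longleftrightarrow> (\<forall>y. birkhoff_orthogonal y x \<longrightarrow> birkhoff_orthogonal x y)"

end

typedef (overloaded) ('k::real_normed_field) ell1 = "{a :: nat \<Rightarrow> 'k. summable (\<lambda>n. norm (a n))}"
  morphisms ell1_nth Abs_ell1
  by (rule exI[of _ "\<lambda>_. 0"]) simp

setup_lifting type_definition_ell1

lemma summable_ell1_nth: "summable (\<lambda>n. norm (ell1_nth a n))"
  using ell1_nth[of a] by simp

lemma ell1_eqI: "(\<And>n. ell1_nth a n = ell1_nth b n) \<Longrightarrow> a = b"
  by (metis ell1_nth_inject ext)

lemma summable_norm_add:
  fixes a b :: "nat \<Rightarrow> 'a::real_normed_vector"
  assumes a: "summable (\<lambda>n. norm (a n))" and b: "summable (\<lambda>n. norm (b n))"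
  shows "summable (\<lambda>n. norm (a n + b n))"
  by (rule summable_comparison_test'[OF summable_add[OF a b]]) (auto intro: norm_triangle_ineq)

instantiation ell1 :: (real_normed_field) real_normed_vector
begin

lift_definition zero_ell1 :: "'a ell1" is "\<lambda>_. 0"
  by simp

lift_definition plus_ell1 :: "'a ell1 \<Rightarrow> 'a ell1 \<Rightarrow> 'a ell1" is "\<lambda>a b n. a n + b n"
  by (rule summable_norm_add)

lift_definition uminus_ell1 :: "'a ell1 \<Rightarrow> 'a ell1" is "\<lambda>a n. - a n"
  by simp

lift_definition minus_ell1 :: "'a ell1 \<Rightarrow> 'a ell1 \<Rightarrow> 'a ell1" is "\<lambda>a b n. a n - b n"
  subgoal for a b
    using summable_norm_add[of a "\<lambda>n. - b n"] by simp
  done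

lift_definition scaleR_ell1 :: "real \<Rightarrow> 'a ell1 \<Rightarrow> 'a ell1" is "\<lambda>r a n. r *\<^sub>R a n"
  by (simp add: summable_mult)

lift_definition norm_ell1 :: "'a ell1 \<Rightarrow> real" is "\<lambda>a. \<Sum>n. norm (a n)" .

definition sgn_ell1 :: "'a ell1 \<Rightarrow> 'a ell1"
  where "sgn_ell1 a = inverse (norm a) *\<^sub>R a"

definition dist_ell1 :: "'a ell1 \<Rightarrow> 'a ell1 \<Rightarrow> real"
  where "dist_ell1 a b = norm (a - b)"

definition uniformity_ell1 :: "('a ell1 \<times> 'a ell1) filter"
  where "uniformity_ell1 = (INF e\<in>{0<..}. principal {(a, b). dist a b < e})"

definition open_ell1 :: "'a ell1 set \<Rightarrow> bool"
  where "open_ell1 U \<longleftrightarrow> (\<forall>a\<in>U. eventually (\<lambda>(a', b). a' = a \<longrightarrow> b \<in> U) uniformity)"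

instance
proof
  fix a b c :: "'a ell1" and r s :: real and U :: "'a ell1 set"
  show "a + b + c = a + (b + c)" by transfer (simp add: add.assoc)
  show "a + b = b + a" by transfer (simp add: add.commute)
  show "0 + a = a" by transfer simp
  show "- a + a = 0" by transfer simp
  show "a - b = a + - b" by transfer simp
  show "r *\<^sub>R (a + b) = r *\<^sub>R a + r *\<^sub>R b" by transfer (simp add: scaleR_add_right)
  show "(r + s) *\<^sub>R a = r *\<^sub>R a + s *\<^sub>R a" by transfer (simp add: scaleR_add_left)
  show "r *\<^sub>R s *\<^sub>R a = (r * s) *\<^sub>R a" by transfer simp
  show "1 *\<^sub>R a = a" by transfer simp
  show "sgn a = inverse (norm a) *\<^sub>R a" by (rule sgn_ell1_def)
  show "dist a b = norm (a - b)" by (rule dist_ell1_def)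
  show "uniformity = (INF e\<in>{0<..}. principal {(a, b :: 'a ell1). dist a b < e})"
    by (rule uniformity_ell1_def)
  show "open U \<longleftrightarrow> (\<forall>a\<in>U. \<forall>\<^sub>F (a', b) in uniformity. a' = a \<longrightarrow> b \<in> U)"
    by (rule open_ell1_def)
  show "norm a = 0 \<longleftrightarrow> a = 0"
    by transfer (auto simp: suminf_eq_zero_iff fun_eq_iff)
  show "norm (a + b) \<le> norm a + norm b"
  proof transfer
    fix a b :: "nat \<Rightarrow> 'a"
    assume a: "summable (\<lambda>n. norm (a n))" and b: "summable (\<lambda>n. norm (b n))"
    show "(\<Sum>n. norm (a n + b n)) \<le> (\<Sum>n. norm (a n)) + (\<Sum>n. norm (b n))"
      unfolding suminf_add[OF a b]
      by (intro suminf_le summable_norm_add summable_add a b norm_triangle_ineq)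
  qed
  show "norm (r *\<^sub>R a) = \<bar>r\<bar> * norm a"
    by transfer (simp add: suminf_mult)
qed

end

lift_definition ell1_scale :: "'k::real_normed_field \<Rightarrow> 'k ell1 \<Rightarrow> 'k ell1" is "\<lambda>c a n. c * a n"
  by (simp add: norm_mult summable_mult)

lift_definition ell1_unit :: "nat \<Rightarrow> 'k::real_normed_field ell1" is "\<lambda>n m. if m = n then 1 else 0"
proof -
  fix n :: nat
  show "summable (\<lambda>m. norm (if m = n then 1 else 0 :: 'k))"
    by (rule summable_finite[of "{n}"]) auto
qed

interpretation ell1: normed_space_over "ell1_scale :: 'k::real_normed_field \<Rightarrow> 'k ell1 \<Rightarrow> 'k ell1"
proof
  fix c d :: 'k and a b :: "'k ell1" and r :: real
  show "ell1_scale c (a + b) = ell1_scale c a + ell1_scale c b"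
    by transfer (simp add: distrib_left)
  show "ell1_scale (c + d) a = ell1_scale c a + ell1_scale d a"
    by transfer (simp add: distrib_right)
  show "ell1_scale c (ell1_scale d a) = ell1_scale (c * d) a"
    by transfer (simp add: mult.assoc)
  show "ell1_scale 1 a = a"
    by transfer simp
  show "ell1_scale (of_real r) a = r *\<^sub>R a"
    by transfer (simp add: scaleR_conv_of_real)
  show "norm (ell1_scale c a) = norm c * norm a"
    by transfer (simp add: norm_mult suminf_mult)
qed

end

theory Submission
  imports Defs
begin

text \<open>
  Moving \<open>a\<close> along \<open>e\<^sub>n\<close> changes a single summand of the norm
  (\<open>norm_ell1_add_scale_unit\<close>), so Birkhoff orthogonality to or from a multiple of \<open>e\<^sub>n\<close> is a
  question about one coordinate: for \<open>c \<noteq> 0\<close>, \<open>a\<close> is orthogonal to \<open>c e\<^sub>n\<close> exactly when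
  \<open>a\<^sub>n = 0\<close> (\<open>birkhoff_orthogonal_scale_unit_iff\<close>), while \<open>c e\<^sub>n\<close> is orthogonal to \<open>a\<close> already
  when \<open>a\<^sub>n\<close> carries at most half of the norm of \<open>a\<close> (\<open>scale_unit_birkhoff_orthogonal\<close>).

  The first condition implies the second, which makes the multiples of \<open>e\<^sub>n\<close> right-symmetric.
  Conversely, if \<open>a\<close> has two nonzero coordinates, let \<open>a\<^sub>i\<close> be the smaller of them in modulus. It
  carries at most half of the norm, so \<open>e\<^sub>i\<close> is orthogonal to \<open>a\<close>; but \<open>a\<close> is not orthogonal to
  \<open>e\<^sub>i\<close>, because \<open>a\<^sub>i \<noteq> 0\<close>. The argument works over every real normed field.
\<close>

lemma norm_ell1_add_scale_unit:
  fixes a :: "'k::real_normed_field ell1"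
  shows "norm (a + ell1_scale c (ell1_unit n))
    = norm a - norm (ell1_nth a n) + norm (ell1_nth a n + c)"
proof transfer
  fix a :: "nat \<Rightarrow> 'k" and c n
  assume "summable (\<lambda>m. norm (a m))"
  then have "(\<lambda>m. norm (a m)) sums (\<Sum>m. norm (a m))"
    by (rule summable_sums)
  moreover have "(\<lambda>m. if m = n then norm (a m + c) - norm (a m) else 0)
      sums (norm (a n + c) - norm (a n))"
    by (rule sums_single)
  ultimately have "(\<lambda>m. norm (a m) + (if m = n then norm (a m + c) - norm (a m) else 0))
      sums ((\<Sum>m. norm (a m)) + (norm (a n + c) - norm (a n)))"
    by (rule sums_add)
  moreover have "(\<lambda>m. norm (a m) + (if m = n then norm (a m + c) - norm (a m) else 0))
      = (\<lambda>m. norm (a m + c * (if m = n then 1 else 0)))"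
    by auto
  ultimately show "(\<Sum>m. norm (a m + c * (if m = n then 1 else 0)))
      = (\<Sum>m. norm (a m)) - norm (a n) + norm (a n + c)"
    by (simp add: sums_iff)
qed

lemma norm_ell1_unit: "norm (ell1_unit n :: 'k::real_normed_field ell1) = 1"
  using norm_ell1_add_scale_unit[of "0 :: 'k ell1" 1 n] by (simp add: zero_ell1.rep_eq)

lemma norm_ell1_ge_two_coordinates:
  fixes a :: "'k::real_normed_field ell1"
  assumes "i \<noteq> j"
  shows "norm (ell1_nth a i) + norm (ell1_nth a j) \<le> norm a"
  using sum_le_suminf[OF summable_ell1_nth[of a], of "{i, j}"] assms
  by (simp add: norm_ell1.rep_eq)

text \<open>The multiple of \<open>e\<^sub>n\<close> that cancels the \<open>n\<close>-th coordinate shortens \<open>a\<close> by \<open>norm a\<^sub>n\<close>.\<close>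

lemma birkhoff_orthogonal_scale_unit_iff:
  fixes a :: "'k::real_normed_field ell1"
  assumes "c \<noteq> 0"
  shows "ell1.birkhoff_orthogonal a (ell1_scale c (ell1_unit n)) \<longleftrightarrow> ell1_nth a n = 0"
proof
  assume "ell1.birkhoff_orthogonal a (ell1_scale c (ell1_unit n))"
  then have "norm (a + ell1_scale (- ell1_nth a n / c) (ell1_scale c (ell1_unit n))) \<ge> norm a"
    unfolding ell1.birkhoff_orthogonal_def by blast
  then have "norm (a + ell1_scale (- ell1_nth a n) (ell1_unit n)) \<ge> norm a"
    using assms by simp
  then show "ell1_nth a n = 0"
    by (subst (asm) norm_ell1_add_scale_unit) simp
next
  assume "ell1_nth a n = 0"
  then show "ell1.birkhoff_orthogonal a (ell1_scale c (ell1_unit n))"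
    by (simp add: ell1.birkhoff_orthogonal_def norm_ell1_add_scale_unit)
qed

text \<open>
  Adding \<open>d a\<close> to \<open>c e\<^sub>n\<close> lowers the \<open>n\<close>-th summand of the norm by at most \<open>norm (d a\<^sub>n)\<close>, and the
  other coordinates of \<open>d a\<close>, whose moduli sum to at least as much, make up for the loss.
\<close>

lemma scale_unit_birkhoff_orthogonal:
  fixes a :: "'k::real_normed_field ell1"
  assumes "2 * norm (ell1_nth a n) \<le> norm a"
  shows "ell1.birkhoff_orthogonal (ell1_scale c (ell1_unit n)) a"
  unfolding ell1.birkhoff_orthogonal_def
proof
  fix d :: 'k
  have "norm d * (2 * norm (ell1_nth a n)) \<le> norm d * norm a"
    using assms by (intro mult_left_mono) auto
  moreover have "norm c \<le> norm (d * ell1_nth a n + c) + norm (d * ell1_nth a n)"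
    using norm_triangle_ineq4[of "d * ell1_nth a n + c" "d * ell1_nth a n"] by simp
  ultimately show "norm (ell1_scale c (ell1_unit n) + ell1_scale d a)
      \<ge> norm (ell1_scale c (ell1_unit n) :: 'k ell1)"
    using norm_ell1_add_scale_unit[of "ell1_scale d a" c n]
    by (simp add: add.commute norm_ell1_unit ell1.norm_scale ell1_scale.rep_eq norm_mult)
qed

lemma right_symmetric_scale_unit:
  "ell1.right_symmetric (ell1_scale c (ell1_unit n) :: 'k::real_normed_field ell1)"
proof (cases "c = 0")
  case True
  then show ?thesis
    by (simp add: ell1.right_symmetric_def ell1.birkhoff_orthogonal_def)
next
  case False
  then show ?thesis
    by (simp add: ell1.right_symmetric_def birkhoff_orthogonal_scale_unit_iff
        scale_unit_birkhoff_orthogonal)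
qed

lemma right_symmetric_nth_eq_0:
  fixes a :: "'k::real_normed_field ell1"
  assumes "ell1.right_symmetric a" and "i \<noteq> j"
    and "norm (ell1_nth a i) \<le> norm (ell1_nth a j)"
  shows "ell1_nth a i = 0"
proof -
  have "2 * norm (ell1_nth a i) \<le> norm a"
    using norm_ell1_ge_two_coordinates[OF assms(2), of a] assms(3) by linarith
  then have "ell1.birkhoff_orthogonal (ell1_scale 1 (ell1_unit i)) a"
    by (rule scale_unit_birkhoff_orthogonal)
  then have "ell1.birkhoff_orthogonal a (ell1_scale 1 (ell1_unit i))"
    using assms(1) unfolding ell1.right_symmetric_def by blast
  then show ?thesis
    by (subst (asm) birkhoff_orthogonal_scale_unit_iff) simp_all
qed

theorem right_symmetric_ell1_iff:
  fixes a :: "'k::real_normed_field ell1"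
  shows "ell1.right_symmetric a \<longleftrightarrow> (\<exists>n c. a = ell1_scale c (ell1_unit n))"
proof
  assume a: "ell1.right_symmetric a"
  obtain i where i: "ell1_nth a j = 0" if "j \<noteq> i" for j
  proof (cases "\<exists>i. ell1_nth a i \<noteq> 0")
    case True
    then obtain i where "ell1_nth a i \<noteq> 0" ..
    then have "ell1_nth a j = 0" if "j \<noteq> i" for j
      using right_symmetric_nth_eq_0[OF a, of i j] right_symmetric_nth_eq_0[OF a, of j i] that
      by fastforce
    then show ?thesis
      by (rule that)
  next
    case False
    then show ?thesis
      using that by blast
  qed
  have "a = ell1_scale (ell1_nth a i) (ell1_unit i)"
    by (rule ell1_eqI) (simp add: i ell1_scale.rep_eq ell1_unit.rep_eq)
  then show "\<exists>n c. a = ell1_scale c (ell1_unit n)"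
    by blast
next
  assume "\<exists>n c. a = ell1_scale c (ell1_unit n)"
  then show "ell1.right_symmetric a"
    using right_symmetric_scale_unit by blast
qed

theorem theorem3p7:
  shows "(\<forall>a :: real ell1.
            ell1.right_symmetric a \<longleftrightarrow> (\<exists>(n::nat) (c::real). a = ell1_scale c (ell1_unit n))) \<and>
         (\<forall>a :: complex ell1.
            ell1.right_symmetric a \<longleftrightarrow> (\<exists>(n::nat) (c::complex). a = ell1_scale c (ell1_unit n)))"
  by (intro conjI allI right_symmetric_ell1_iff)

end
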